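(* Let $\mathcal{A}$ be a dual Banach algebra with a central approximate identity. If $\mathcal{A}$ is Connes biprojective, then $\mathcal{A}$ is strong pseudo-Connes amenable.
   Context: A Banach algebra $\mathcal{A}$ is a dual Banach algebra if there is a closed submodule $\mathcal{A}_*$ of the dual bimodule $\mathcal{A}^*$ with $\mathcal{A}=(\mathcal{A}_* )^*$; the $wk^*$-topology on $\mathcal{A}$ is $\sigma(\mathcal{A},\mathcal{A}_* )$. For a Banach $\mathcal{A}$-bimodule $E$, $\sigma wc(E)$ is the closed submodule of all $x\in E$ such that the maps $\mathcal{A}\to E$, $a\mapsto a\cdot x$ and $a\mapsto x\cdot a$, are $wk^*$-$wk$-continuous. The projective tensor product $\mathcal{A}\hat\otimes\mathcal{A}$ is an $\mathcal{A}$-bimodule via $a\cdot(b\otimes c)=ab\otimes c$, $(b\otimes c)\cdot a=b\otimes ca$; duals carry the dual module actions. Write $\sigma wc(\mathcal{A}\hat\otimes\mathcal{A})^*$ for $\sigma wc((\mathcal{A}\hat\otimes\mathcal{A})^* )$. Let $\pi:\mathcal{A}\hat\otimes\mathcal{A}\to\mathcal{A}$, $\pi(a\otimes b)=ab$. Then $\pi^*$ maps $\mathcal{A}_*$ into $\sigma wc(\mathcal{A}\hat\otimes\mathcal{A})^*$, and $\pi_{\sigma wc}:(\sigma wc(\mathcal{A}\hat\otimes\mathcal{A})^* )^*\to\mathcal{A}$ denotes the adjoint of $\pi^*|_{\mathcal{A}_*}$; it is an $\mathcal{A}$-bimodule morphism. $\mathcal{A}$ is strong pseudo-Connes amenable if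 there is a (not necessarily bounded) net $(m_\alpha)$ in $(\sigma wc(\mathcal{A}\hat\otimes\mathcal{A})^* )^*$ such that for every $a\in\mathcal{A}$: (i) $a\cdot m_\alpha-m_\alpha\cdot a\to0$ in the $wk^*$-topology of $(\sigma wc(\mathcal{A}\hat\otimes\mathcal{A})^* )^*$; (ii) $a\,\pi_{\sigma wc}(m_\alpha)=\pi_{\sigma wc}(m_\alpha)\,a$ for all $\alpha$, and $a\,\pi_{\sigma wc}(m_\alpha)\to a$ in the $wk^*$-topology of $\mathcal{A}$. $\mathcal{A}$ is Connes biprojective if there is a bounded $\mathcal{A}$-bimodule morphism $\rho:\mathcal{A}\to(\sigma wc(\mathcal{A}\hat\otimes\mathcal{A})^* )^*$ with $\pi_{\sigma wc}\circ\rho=\mathrm{id}_{\mathcal{A}}$. A central approximate identity is a (not necessarily bounded) net $(e_\alpha)$ in $\mathcal{A}$ with $ae_\alpha=e_\alpha a$ and $e_\alpha a\to a$ in norm for every $a\in\mathcal{A}$. *)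

theory Defs
  imports "HOL-Analysis.Analysis" "HOL-Library.Function_Algebras"
begin

section \<open>Complex Banach algebras\<close>

class complex_vector = ab_group_add +
  fixes scaleC :: "complex \<Rightarrow> 'a \<Rightarrow> 'a"  (infixr \<open>*\<^sub>C\<close> 75)
  assumes scaleC_add_right: "c *\<^sub>C (x + y) = c *\<^sub>C x + c *\<^sub>C y"
    and scaleC_add_left: "(c + d) *\<^sub>C x = c *\<^sub>C x + d *\<^sub>C x"
    and scaleC_scaleC: "c *\<^sub>C d *\<^sub>C x = (c * d) *\<^sub>C x"
    and scaleC_one: "1 *\<^sub>C x = x"

instantiation complex :: complex_vector
begin

definition scaleC_complex :: "complex \<Rightarrow> complex \<Rightarrow> complex"
  where [simp]: "scaleC_complex c x = c * x"

instance
  by standard (simp_all add: algebra_simps)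

end

instantiation "fun" :: (type, complex_vector) complex_vector
begin

definition scaleC_fun :: "complex \<Rightarrow> ('a \<Rightarrow> 'b) \<Rightarrow> 'a \<Rightarrow> 'b"
  where "scaleC_fun c f = (\<lambda>x. c *\<^sub>C f x)"

instance
  by standard
    (simp_all add: scaleC_fun_def fun_eq_iff scaleC_add_right scaleC_add_left scaleC_scaleC scaleC_one)

end

text \<open>Banach algebras are complex and need not be unital.\<close>

class complex_banach_algebra = complex_vector + real_normed_algebra + banach +
  assumes scaleR_scaleC: "r *\<^sub>R x = complex_of_real r *\<^sub>C x"
    and norm_scaleC: "norm (c *\<^sub>C x) = cmod c * norm x"
    and mult_scaleC_left: "(c *\<^sub>C x) * y = c *\<^sub>C (x * y)"
    and mult_scaleC_right: "x * (c *\<^sub>C y) = c *\<^sub>C (x * y)"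

section \<open>Bimodules and their duals\<close>

text \<open>
  A normed bimodule over the algebra \<open>'a\<close> is given by a linear subspace \<open>carr\<close> of a complex vector
  space \<open>'e\<close>, with a norm and two actions that are only meaningful on \<open>carr\<close>. Addition and scalar
  multiplication are those of \<open>'e\<close>.
\<close>

record ('a, 'e) bimodule =
  carr :: "'e set"
  nrm :: "'e \<Rightarrow> real"
  lact :: "'a \<Rightarrow> 'e \<Rightarrow> 'e"
  ract :: "'e \<Rightarrow> 'a \<Rightarrow> 'e"

definition clinear_on :: "'e::complex_vector set \<Rightarrow> ('e \<Rightarrow> 'f::complex_vector) \<Rightarrow> bool"
  where "clinear_on S f \<longleftrightarrow>
    (\<forall>x\<in>S. \<forall>y\<in>S. f (x + y) = f x + f y) \<and> (\<forall>c. \<forall>x\<in>S. f (c *\<^sub>C x) = c *\<^sub>C f x)"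

definition algebra_bimodule :: "('a::complex_banach_algebra, 'a) bimodule"
  where "algebra_bimodule = \<lparr>carr = UNIV, nrm = norm, lact = times, ract = times\<rparr>"

text \<open>Functionals on \<open>carr E\<close> are extended by 0, so that they are equal iff they agree on \<open>carr E\<close>.\<close>

definition dual :: "('a, 'e::complex_vector) bimodule \<Rightarrow> ('a, 'e \<Rightarrow> complex) bimodule"
  where "dual E =
    \<lparr>carr = {f. clinear_on (carr E) f \<and> (\<exists>K. \<forall>x\<in>carr E. cmod (f x) \<le> K * nrm E x)
                \<and> (\<forall>x. x \<notin> carr E \<longrightarrow> f x = 0)},
     nrm = (\<lambda>f. SUP x\<in>{x \<in> carr E. nrm E x \<le> 1}. cmod (f x)),
     lact = (\<lambda>a f x. if x \<in> carr E then f (ract E x a) else 0),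
     ract = (\<lambda>f a x. if x \<in> carr E then f (lact E a x) else 0)\<rparr>"

definition closed_submodule :: "'e set \<Rightarrow> ('a, 'e::complex_vector) bimodule \<Rightarrow> bool"
  where "closed_submodule S E \<longleftrightarrow>
    S \<subseteq> carr E \<and> 0 \<in> S \<and> (\<forall>x\<in>S. \<forall>y\<in>S. x + y \<in> S) \<and> (\<forall>c. \<forall>x\<in>S. c *\<^sub>C x \<in> S) \<and>
    (\<forall>a. \<forall>x\<in>S. lact E a x \<in> S \<and> ract E x a \<in> S) \<and>
    (\<forall>x\<in>carr E. (\<forall>\<epsilon>>0. \<exists>y\<in>S. nrm E (x - y) < \<epsilon>) \<longrightarrow> x \<in> S)"

text \<open>The coarsest topology on \<open>X\<close> making all functions in \<open>\<Phi>\<close> continuous, i.e. \<open>\<sigma>(X, \<Phi>)\<close>.\<close>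

definition initial_topology :: "'e set \<Rightarrow> ('e \<Rightarrow> complex) set \<Rightarrow> 'e topology"
  where "initial_topology X \<Phi> =
    topology_generated_by (insert X {X \<inter> f -` U | f U. f \<in> \<Phi> \<and> open U})"

definition weak_topology :: "('a, 'e::complex_vector) bimodule \<Rightarrow> 'e topology"
  where "weak_topology E = initial_topology (carr E) (carr (dual E))"

definition weak_star_dual :: "('a, 'e::complex_vector) bimodule \<Rightarrow> ('e \<Rightarrow> complex) topology"
  where "weak_star_dual E = initial_topology (carr (dual E)) ((\<lambda>x f. f x) ` carr E)"

section \<open>Dual Banach algebras\<close>

definition predual_module :: "('a::complex_banach_algebra \<Rightarrow> complex) set \<Rightarrow> ('a, 'a \<Rightarrow> complex) bimodule"
  where "predual_module P = (dual algebra_bimodule)\<lparr>carr := P\<rparr>"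

definition eval_on :: "('a \<Rightarrow> complex) set \<Rightarrow> 'a \<Rightarrow> ('a \<Rightarrow> complex) \<Rightarrow> complex"
  where "eval_on P a = (\<lambda>\<phi>. if \<phi> \<in> P then \<phi> a else 0)"

text \<open>\<open>P\<close> plays the role of the predual: \<open>eval_on P\<close> identifies the algebra isometrically with the
  dual space of \<open>P\<close>.\<close>

definition dual_banach_algebra :: "('a::complex_banach_algebra \<Rightarrow> complex) set \<Rightarrow> bool"
  where "dual_banach_algebra P \<longleftrightarrow>
    closed_submodule P (dual algebra_bimodule) \<and>
    bij_betw (eval_on P) UNIV (carr (dual (predual_module P))) \<and>
    (\<forall>a. nrm (dual (predual_module P)) (eval_on P a) = norm a)"

definition weak_star :: "('a::complex_banach_algebra \<Rightarrow> complex) set \<Rightarrow> 'a topology"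
  where "weak_star P = initial_topology UNIV P"

definition sigma_wc ::
  "('a::complex_banach_algebra \<Rightarrow> complex) set \<Rightarrow> ('a, 'e::complex_vector) bimodule \<Rightarrow> ('a, 'e) bimodule"
  where "sigma_wc P E = E\<lparr>carr := {x \<in> carr E.
    continuous_map (weak_star P) (weak_topology E) (\<lambda>a. lact E a x) \<and>
    continuous_map (weak_star P) (weak_topology E) (\<lambda>a. ract E x a)}\<rparr>"

section \<open>The projective tensor product\<close>

type_synonym 'a tensor = "('a \<Rightarrow> 'a \<Rightarrow> complex) \<Rightarrow> complex"

definition bounded_bilinear_forms :: "('a::complex_banach_algebra \<Rightarrow> 'a \<Rightarrow> complex) set"
  where "bounded_bilinear_forms = {B.
    (\<forall>a. clinear_on UNIV (B a)) \<and> (\<forall>b. clinear_on UNIV (\<lambda>a. B a b)) \<and>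
    (\<exists>K. \<forall>a b. cmod (B a b) \<le> K * norm a * norm b)}"

text \<open>
  The elementary tensor \<open>a \<otimes> b\<close> is the evaluation of bounded bilinear forms at \<open>(a, b)\<close>. The elements of
  the projective tensor product are the sums \<open>\<Sum>n. x n \<otimes> y n\<close> with \<open>(\<Sum>n. \<parallel>x n\<parallel> \<parallel>y n\<parallel>) < \<infinity>\<close>, and
  their projective norm is the infimum of \<open>\<Sum>n. \<parallel>x n\<parallel> \<parallel>y n\<parallel>\<close> over all such representations. (The dual
  of the completed projective tensor product is the space of bounded bilinear forms, which therefore
  separates its points.)
\<close>

definition tens :: "'a::complex_banach_algebra \<Rightarrow> 'a \<Rightarrow> 'a tensor"
  where "tens a b = (\<lambda>B. if B \<in> bounded_bilinear_forms then B a b else 0)"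

definition represents ::
  "(nat \<Rightarrow> 'a::complex_banach_algebra) \<Rightarrow> (nat \<Rightarrow> 'a) \<Rightarrow> 'a tensor \<Rightarrow> bool"
  where "represents x y u \<longleftrightarrow>
    summable (\<lambda>n. norm (x n) * norm (y n)) \<and> u = (\<lambda>B. \<Sum>n. tens (x n) (y n) B)"

definition proj_tensor :: "('a::complex_banach_algebra, 'a tensor) bimodule"
  where "proj_tensor =
    \<lparr>carr = {u. \<exists>x y. represents x y u},
     nrm = (\<lambda>u. INF (x, y)\<in>{(x, y). represents x y u}. \<Sum>n. norm (x n) * norm (y n)),
     lact = (\<lambda>a u B. if B \<in> bounded_bilinear_forms then u (\<lambda>b c. B (a * b) c) else 0),
     ract = (\<lambda>u a B. if B \<in> bounded_bilinear_forms then u (\<lambda>b c. B b (c * a)) else 0)\<rparr>"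

text \<open>The product map \<open>\<pi>\<close>, as the sum \<open>\<Sum>n. x n * y n\<close> for any representation of \<open>u\<close>.\<close>

definition prod_map :: "'a::complex_banach_algebra tensor \<Rightarrow> 'a"
  where "prod_map u = (THE c. \<exists>x y. represents x y u \<and> c = (\<Sum>n. x n * y n))"

text \<open>The module actions and the product map have the intended values.\<close>

lemma bounded_bilinear_forms_mult:
  fixes a :: "'a::complex_banach_algebra"
  assumes "B \<in> bounded_bilinear_forms"
  shows "(\<lambda>b c. B (a * b) c) \<in> bounded_bilinear_forms"
    and "(\<lambda>b c. B b (c * a)) \<in> bounded_bilinear_forms"
proof -
  obtain K where K: "\<And>b c. cmod (B b c) \<le> K * norm b * norm c"
    using assms unfolding bounded_bilinear_forms_def by blast
  have K': "cmod (B b c) \<le> \<bar>K\<bar> * norm b * norm c" for b c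
    using K[of b c] mult_right_mono[OF mult_right_mono[OF abs_ge_self, of "norm b" K], of "norm c"]
    by simp
  have "cmod (B (a * b) c) \<le> (\<bar>K\<bar> * norm a) * norm b * norm c" for b c
  proof -
    have "cmod (B (a * b) c) \<le> \<bar>K\<bar> * norm (a * b) * norm c"
      by (rule K')
    also have "\<dots> \<le> \<bar>K\<bar> * (norm a * norm b) * norm c"
      by (intro mult_right_mono mult_left_mono norm_mult_ineq) auto
    finally show ?thesis by (simp add: mult_ac)
  qed
  then show "(\<lambda>b c. B (a * b) c) \<in> bounded_bilinear_forms"
    using assms unfolding bounded_bilinear_forms_def clinear_on_def
    by (auto simp: distrib_left mult_scaleC_right)
  have "cmod (B b (c * a)) \<le> (\<bar>K\<bar> * norm a) * norm b * norm c" for b c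
  proof -
    have "cmod (B b (c * a)) \<le> \<bar>K\<bar> * norm b * norm (c * a)"
      by (rule K')
    also have "\<dots> \<le> \<bar>K\<bar> * norm b * (norm c * norm a)"
      by (intro mult_left_mono norm_mult_ineq) auto
    finally show ?thesis by (simp add: mult_ac)
  qed
  then show "(\<lambda>b c. B b (c * a)) \<in> bounded_bilinear_forms"
    using assms unfolding bounded_bilinear_forms_def clinear_on_def
    by (auto simp: distrib_right mult_scaleC_left)
qed

lemma lact_tens: "lact proj_tensor a (tens b c) = tens (a * b) c"
  by (auto simp: proj_tensor_def tens_def fun_eq_iff bounded_bilinear_forms_mult)

lemma ract_tens: "ract proj_tensor (tens b c) a = tens b (c * a)"
  by (auto simp: proj_tensor_def tens_def fun_eq_iff bounded_bilinear_forms_mult)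

lemma prod_map_eq:
  fixes P :: "('a::complex_banach_algebra \<Rightarrow> complex) set" and u :: "'a tensor"
  assumes P: "dual_banach_algebra P" and rep: "represents x y u"
  shows "prod_map u = (\<Sum>n. x n * y n)"
proof -
  have eval: "\<phi> (\<Sum>n. x n * y n) = u (\<lambda>a b. \<phi> (a * b))"
    if rep: "represents x y u" and "\<phi> \<in> P" for x y :: "nat \<Rightarrow> 'a" and \<phi>
  proof -
    have "\<phi> \<in> carr (dual algebra_bimodule)"
      using P \<open>\<phi> \<in> P\<close> by (auto simp: dual_banach_algebra_def closed_submodule_def)
    then obtain K where lin: "clinear_on UNIV \<phi>" and K: "\<And>a. cmod (\<phi> a) \<le> K * norm a"
      by (auto simp: dual_def algebra_bimodule_def)
    have bl: "bounded_linear \<phi>"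
    proof (rule bounded_linear_intro)
      show "\<phi> (a + b) = \<phi> a + \<phi> b" for a b
        using lin by (auto simp: clinear_on_def)
      show "\<phi> (r *\<^sub>R a) = r *\<^sub>R \<phi> a" for r a
        using lin by (auto simp: clinear_on_def scaleR_scaleC scaleR_conv_of_real)
      show "norm (\<phi> a) \<le> norm a * K" for a
        using K[of a] by (simp add: mult.commute)
    qed
    have "cmod (\<phi> (a * b)) \<le> \<bar>K\<bar> * norm a * norm b" for a b
    proof -
      have "cmod (\<phi> (a * b)) \<le> \<bar>K\<bar> * norm (a * b)"
        using K[of "a * b"] mult_right_mono[OF abs_ge_self, of "norm (a * b)" K] by simp
      also have "\<dots> \<le> \<bar>K\<bar> * (norm a * norm b)"
        by (intro mult_left_mono norm_mult_ineq) auto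
      finally show ?thesis by (simp add: mult_ac)
    qed
    then have B: "(\<lambda>a b. \<phi> (a * b)) \<in> bounded_bilinear_forms"
      using lin unfolding bounded_bilinear_forms_def mem_Collect_eq
      by (intro conjI allI exI[of _ "\<bar>K\<bar>"])
        (simp_all add: clinear_on_def distrib_left distrib_right mult_scaleC_right mult_scaleC_left)
    have "summable (\<lambda>n. norm (x n * y n))"
    proof (rule summable_comparison_test')
      show "summable (\<lambda>n. norm (x n) * norm (y n))"
        using rep by (simp add: represents_def)
      show "norm (norm (x n * y n)) \<le> norm (x n) * norm (y n)" if "0 \<le> n" for n
        by (simp add: norm_mult_ineq)
    qed
    from this[THEN summable_norm_cancel]
    have "\<phi> (\<Sum>n. x n * y n) = (\<Sum>n. \<phi> (x n * y n))"
      by (rule bounded_linear.suminf[OF bl])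
    also have "\<dots> = u (\<lambda>a b. \<phi> (a * b))"
    proof -
      have u: "u = (\<lambda>B. \<Sum>n. tens (x n) (y n) B)"
        using rep by (simp add: represents_def)
      show ?thesis
        unfolding u tens_def using B by simp
    qed
    finally show ?thesis .
  qed
  have inj: "c = d" if "\<And>\<phi>. \<phi> \<in> P \<Longrightarrow> \<phi> c = \<phi> d" for c d :: 'a
  proof -
    have "eval_on P c = eval_on P d"
      using that by (auto simp: eval_on_def)
    then show ?thesis
      using P unfolding dual_banach_algebra_def bij_betw_def by (blast dest: injD)
  qed
  show ?thesis
    unfolding prod_map_def
  proof (rule the_equality)
    show "\<exists>x' y'. represents x' y' u \<and> (\<Sum>n. x n * y n) = (\<Sum>n. x' n * y' n)"
      using rep by blast
    show "c = (\<Sum>n. x n * y n)" if "\<exists>x' y'. represents x' y' u \<and> c = (\<Sum>n. x' n * y' n)" for c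
    proof (rule inj)
      fix \<phi> assume "\<phi> \<in> P"
      from that obtain x' y' where "represents x' y' u" "c = (\<Sum>n. x' n * y' n)"
        by blast
      then show "\<phi> c = \<phi> (\<Sum>n. x n * y n)"
        using eval[OF _ \<open>\<phi> \<in> P\<close>] rep by metis
    qed
  qed
qed

definition prod_map_adj :: "('a::complex_banach_algebra \<Rightarrow> complex) \<Rightarrow> 'a tensor \<Rightarrow> complex"
  where "prod_map_adj \<phi> = (\<lambda>u. if u \<in> carr proj_tensor then \<phi> (prod_map u) else 0)"

definition swc_tensor ::
  "('a::complex_banach_algebra \<Rightarrow> complex) set \<Rightarrow> ('a, 'a tensor \<Rightarrow> complex) bimodule"
  where "swc_tensor P = sigma_wc P (dual proj_tensor)"

text \<open>The adjoint of \<open>prod_map_adj\<close> restricted to the predual, followed by the identification of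
  the dual of \<open>P\<close> with the algebra.\<close>

definition pi_swc ::
  "('a::complex_banach_algebra \<Rightarrow> complex) set \<Rightarrow> (('a tensor \<Rightarrow> complex) \<Rightarrow> complex) \<Rightarrow> 'a"
  where "pi_swc P m =
    inv_into UNIV (eval_on P) (\<lambda>\<phi>. if \<phi> \<in> P then m (prod_map_adj \<phi>) else 0)"

section \<open>Nets\<close>

definition directed_set :: "'i set \<Rightarrow> ('i \<Rightarrow> 'i \<Rightarrow> bool) \<Rightarrow> bool"
  where "directed_set I le \<longleftrightarrow> I \<noteq> {} \<and> reflp_on I le \<and> transp_on I le \<and>
    (\<forall>i\<in>I. \<forall>j\<in>I. \<exists>k\<in>I. le i k \<and> le j k)"

definition net_filter :: "'i set \<Rightarrow> ('i \<Rightarrow> 'i \<Rightarrow> bool) \<Rightarrow> 'i filter"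
  where "net_filter I le = (INF i\<in>I. principal {j \<in> I. le i j})"

lemma eventually_net_filter:
  assumes "directed_set I le"
  shows "eventually Q (net_filter I le) \<longleftrightarrow> (\<exists>i\<in>I. \<forall>j\<in>I. le i j \<longrightarrow> Q j)"
proof -
  have "eventually Q (net_filter I le) \<longleftrightarrow> (\<exists>i\<in>I. eventually Q (principal {j \<in> I. le i j}))"
    unfolding net_filter_def
  proof (rule eventually_INF_base)
    show "I \<noteq> {}"
      using assms by (simp add: directed_set_def)
    fix i j assume ij: "i \<in> I" "j \<in> I"
    then obtain k where k: "k \<in> I" "le i k" "le j k"
      using assms unfolding directed_set_def by meson
    have "{l \<in> I. le k l} \<subseteq> {l \<in> I. le i l} \<inter> {l \<in> I. le j l}"
      using assms ij k unfolding directed_set_def transp_on_def by blast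
    then show "\<exists>k\<in>I. principal {l \<in> I. le k l} \<le>
        inf (principal {l \<in> I. le i l}) (principal {l \<in> I. le j l})"
      using k by (intro bexI[of _ k]) simp_all
  qed
  then show ?thesis
    by (auto simp: eventually_principal)
qed

text \<open>
  Every net in \<open>'x\<close> can be replaced by one whose index set lives in the type \<open>'x set \<times> 'x\<close>, with the
  same range and the same tails. Hence quantifying over nets with that index type loses nothing.
\<close>

lemma net_reindex:
  fixes m :: "'i \<Rightarrow> 'x"
  assumes "directed_set I le"
  obtains J :: "('x set \<times> 'x) set" and le' n where
    "directed_set J le'" "n ` J = m ` I"
    "filtermap n (net_filter J le') = filtermap m (net_filter I le)"
proof -
  define T where "T i = m ` {j \<in> I. le i j}" for i
  define J where "J = {(T i, m j) | i j. i \<in> I \<and> j \<in> I \<and> le i j}"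
  define le' :: "'x set \<times> 'x \<Rightarrow> 'x set \<times> 'x \<Rightarrow> bool" where "le' p q \<longleftrightarrow> fst q \<subseteq> fst p" for p q
  have refl: "le i i" if "i \<in> I" for i
    using assms that by (auto simp: directed_set_def reflp_on_def)
  have trans: "le i k" if "i \<in> I" "j \<in> I" "k \<in> I" "le i j" "le j k" for i j k
    using assms that unfolding directed_set_def transp_on_def by blast
  have T_mono: "T j \<subseteq> T i" if "i \<in> I" "j \<in> I" "le i j" for i j
    unfolding T_def using trans that by blast
  have inJ: "(T i, m i) \<in> J" if "i \<in> I" for i
    unfolding J_def using refl that by blast
  have dir: "directed_set J le'"
    unfolding directed_set_def
  proof (intro conjI ballI)
    show "J \<noteq> {}"
      using assms inJ by (auto simp: directed_set_def)
    show "reflp_on J le'" "transp_on J le'"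
      by (auto simp: le'_def reflp_on_def transp_on_def)
    fix p q assume "p \<in> J" "q \<in> J"
    then obtain i j where ij: "i \<in> I" "j \<in> I" "fst p = T i" "fst q = T j"
      unfolding J_def by auto
    then obtain k where "k \<in> I" "le i k" "le j k"
      using assms unfolding directed_set_def by meson
    then show "\<exists>r\<in>J. le' p r \<and> le' q r"
      using ij T_mono inJ by (intro bexI[of _ "(T k, m k)"]) (auto simp: le'_def)
  qed
  have snd_J: "snd q \<in> m ` I \<and> snd q \<in> fst q \<and> (\<exists>i\<in>I. fst q = T i)" if "q \<in> J" for q
    using that unfolding J_def T_def by auto
  have "snd ` J = m ` I"
  proof
    show "snd ` J \<subseteq> m ` I"
      using snd_J by blast
    show "m ` I \<subseteq> snd ` J"
    proof
      fix x assume "x \<in> m ` I"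
      then obtain i where "i \<in> I" "x = m i"
        by blast
      then show "x \<in> snd ` J"
        using inJ[of i] by (intro image_eqI[of _ snd "(T i, m i)"]) simp_all
    qed
  qed
  moreover have "filtermap snd (net_filter J le') = filtermap m (net_filter I le)"
  proof (rule filter_eq_iff[THEN iffD2], rule allI)
    fix Q :: "'x \<Rightarrow> bool"
    have "(\<exists>p\<in>J. \<forall>q\<in>J. le' p q \<longrightarrow> Q (snd q)) \<longleftrightarrow> (\<exists>i\<in>I. \<forall>j\<in>I. le i j \<longrightarrow> Q (m j))"
    proof
      assume "\<exists>p\<in>J. \<forall>q\<in>J. le' p q \<longrightarrow> Q (snd q)"
      then obtain p where "p \<in> J" and p: "\<And>q. q \<in> J \<Longrightarrow> le' p q \<Longrightarrow> Q (snd q)"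
        by blast
      then obtain i where i: "i \<in> I" "fst p = T i"
        using snd_J by blast
      have "Q (m j)" if "j \<in> I" "le i j" for j
        using p[OF inJ[of j]] T_mono[of i j] that i by (simp add: le'_def)
      then show "\<exists>i\<in>I. \<forall>j\<in>I. le i j \<longrightarrow> Q (m j)"
        using i by blast
    next
      assume "\<exists>i\<in>I. \<forall>j\<in>I. le i j \<longrightarrow> Q (m j)"
      then obtain i where i: "i \<in> I" and Q: "\<And>x. x \<in> T i \<Longrightarrow> Q x"
        unfolding T_def by blast
      show "\<exists>p\<in>J. \<forall>q\<in>J. le' p q \<longrightarrow> Q (snd q)"
      proof (intro bexI[OF _ inJ[OF i]] ballI impI)
        fix q assume "q \<in> J" "le' (T i, m i) q"
        then show "Q (snd q)"
          using snd_J[of q] Q by (auto simp: le'_def)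
      qed
    qed
    then show "eventually Q (filtermap snd (net_filter J le')) =
        eventually Q (filtermap m (net_filter I le))"
      by (simp add: eventually_filtermap eventually_net_filter dir assms)
  qed
  ultimately show thesis
    using that dir by blast
qed

section \<open>The notions of the theorem\<close>

definition central_approximate_identity ::
  "'i set \<Rightarrow> ('i \<Rightarrow> 'i \<Rightarrow> bool) \<Rightarrow> ('i \<Rightarrow> 'a::complex_banach_algebra) \<Rightarrow> bool"
  where "central_approximate_identity I le e \<longleftrightarrow> directed_set I le \<and>
    (\<forall>a. (\<forall>i\<in>I. a * e i = e i * a) \<and> ((\<lambda>i. e i * a) \<longlongrightarrow> a) (net_filter I le))"

text \<open>The index set of the net ranges over a fixed type; by \<open>net_reindex\<close> this is no restriction.\<close>

definition strong_pseudo_Connes_amenable :: "('a::complex_banach_algebra \<Rightarrow> complex) set \<Rightarrow> bool"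
  where "strong_pseudo_Connes_amenable P \<longleftrightarrow>
    (\<exists>(I :: ((('a tensor \<Rightarrow> complex) \<Rightarrow> complex) set \<times> (('a tensor \<Rightarrow> complex) \<Rightarrow> complex)) set) le m.
      directed_set I le \<and> (\<forall>i\<in>I. m i \<in> carr (dual (swc_tensor P))) \<and>
      (\<forall>a. limitin (weak_star_dual (swc_tensor P))
              (\<lambda>i. lact (dual (swc_tensor P)) a (m i) - ract (dual (swc_tensor P)) (m i) a)
              0 (net_filter I le) \<and>
           (\<forall>i\<in>I. a * pi_swc P (m i) = pi_swc P (m i) * a) \<and>
           limitin (weak_star P) (\<lambda>i. a * pi_swc P (m i)) a (net_filter I le)))"

definition bounded_morphism_from_algebra ::
  "('a::complex_banach_algebra, 'e::complex_vector) bimodule \<Rightarrow> ('a \<Rightarrow> 'e) \<Rightarrow> bool"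
  where "bounded_morphism_from_algebra E \<rho> \<longleftrightarrow>
    (\<forall>a. \<rho> a \<in> carr E) \<and> clinear_on UNIV \<rho> \<and> (\<exists>K. \<forall>a. nrm E (\<rho> a) \<le> K * norm a) \<and>
    (\<forall>a b. \<rho> (a * b) = lact E a (\<rho> b) \<and> \<rho> (a * b) = ract E (\<rho> a) b)"

definition Connes_biprojective :: "('a::complex_banach_algebra \<Rightarrow> complex) set \<Rightarrow> bool"
  where "Connes_biprojective P \<longleftrightarrow>
    (\<exists>\<rho>. bounded_morphism_from_algebra (dual (swc_tensor P)) \<rho> \<and> (\<forall>a. pi_swc P (\<rho> a) = a))"

end

theory Submission
  imports Defs
begin

text \<open>
  A splitting \<open>\<rho>\<close> of \<open>\<pi>\<^sub>\<sigma>\<^sub>w\<^sub>c\<close> carries a central approximate identity \<open>e\<close> to the required net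
  \<open>m i = \<rho> (e i)\<close>. Centrality makes the first condition hold exactly and not only in the limit: as
  \<open>\<rho>\<close> is a bimodule morphism, \<open>a \<cdot> \<rho> (e i) - \<rho> (e i) \<cdot> a = \<rho> (a * e i) - \<rho> (e i * a) = 0\<close>. As
  \<open>\<pi>\<^sub>\<sigma>\<^sub>w\<^sub>c (\<rho> (e i)) = e i\<close>, the second condition is centrality of \<open>e\<close> together with norm convergence
  of \<open>a * e i\<close> to \<open>a\<close>, and the norm topology is finer than the \<open>wk\<^sup>*\<close>-topology because the predual
  consists of bounded functionals (\<open>limitin_weak_star\<close>).

  The index type of the approximate identity is arbitrary, whereas strong pseudo-Connes amenability
  asks for a net with one particular index type. The net \<open>m\<close> is therefore replaced by a reindexed
  one with the same range and the same image filter; both conditions depend on these data only.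
\<close>

lemma predual_functional_continuous:
  assumes "dual_banach_algebra P" and "\<phi> \<in> P"
  shows "continuous_on UNIV \<phi>"
proof -
  have "\<phi> \<in> carr (dual algebra_bimodule)"
    using assms by (auto simp: dual_banach_algebra_def closed_submodule_def)
  then obtain K where lin: "clinear_on UNIV \<phi>" and K: "\<And>a. cmod (\<phi> a) \<le> K * norm a"
    by (auto simp: dual_def algebra_bimodule_def)
  have "bounded_linear \<phi>"
  proof (rule bounded_linear_intro)
    show "\<phi> (a + b) = \<phi> a + \<phi> b" for a b
      using lin by (auto simp: clinear_on_def)
    show "\<phi> (r *\<^sub>R a) = r *\<^sub>R \<phi> a" for r a
      using lin by (auto simp: clinear_on_def scaleR_scaleC scaleR_conv_of_real)
    show "norm (\<phi> a) \<le> norm a * K" for a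
      using K[of a] by (simp add: mult.commute)
  qed
  then show ?thesis
    by (rule linear_continuous_on)
qed

lemma topspace_initial_topology [simp]: "topspace (initial_topology X \<Phi>) = X"
  by (auto simp: initial_topology_def)

lemma continuous_map_euclidean_initial_topology:
  assumes "\<And>\<phi>. \<phi> \<in> \<Phi> \<Longrightarrow> continuous_on UNIV \<phi>"
  shows "continuous_map euclidean (initial_topology UNIV \<Phi>) id"
  unfolding initial_topology_def
proof (rule continuous_on_generated_topo)
  fix V assume "V \<in> insert UNIV {UNIV \<inter> \<phi> -` U |\<phi> U. \<phi> \<in> \<Phi> \<and> open U}"
  then show "openin euclidean (id -` V \<inter> topspace euclidean)"
    using assms by (auto intro: open_vimage)
qed auto

lemma limitin_weak_star:
  assumes "dual_banach_algebra P" and "(f \<longlongrightarrow> l) F"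
  shows "limitin (weak_star P) f l F"
proof -
  have "limitin euclidean f l F"
    using assms(2) by simp
  moreover have "continuous_map euclidean (weak_star P) id"
    unfolding weak_star_def
    by (intro continuous_map_euclidean_initial_topology predual_functional_continuous[OF assms(1)])
  ultimately show ?thesis
    using continuous_map_limit[of euclidean "weak_star P" id f l F] by (simp add: o_def)
qed

lemma zero_in_carr_dual: "0 \<in> carr (dual E)"
  by (auto simp: dual_def clinear_on_def intro: exI[of _ 0])

lemma limitin_filtermap_cong:
  assumes "filtermap m F = filtermap n G"
  shows "limitin T (\<lambda>i. h (m i)) l F \<longleftrightarrow> limitin T (\<lambda>j. h (n j)) l G"
proof -
  have "eventually (\<lambda>i. Q (m i)) F \<longleftrightarrow> eventually (\<lambda>j. Q (n j)) G" for Q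
    using assms by (metis eventually_filtermap)
  from this[of "\<lambda>x. h x \<in> _"] show ?thesis
    by (simp add: limitin_def)
qed

theorem proposition2p8:
  fixes P :: "('a::complex_banach_algebra \<Rightarrow> complex) set"
    and I :: "'i set" and le :: "'i \<Rightarrow> 'i \<Rightarrow> bool" and e :: "'i \<Rightarrow> 'a"
  assumes "dual_banach_algebra P"
    and "central_approximate_identity I le e"
    and "Connes_biprojective P"
  shows "strong_pseudo_Connes_amenable P"
proof -
  let ?E = "dual (swc_tensor P)"
  from assms(3) obtain \<rho> where mor: "bounded_morphism_from_algebra ?E \<rho>"
    and split: "\<And>a. pi_swc P (\<rho> a) = a"
    unfolding Connes_biprojective_def by blast
  have carr: "\<rho> a \<in> carr ?E" and left: "\<rho> (a * b) = lact ?E a (\<rho> b)"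
    and right: "\<rho> (a * b) = ract ?E (\<rho> a) b" for a b
    using mor unfolding bounded_morphism_from_algebra_def by blast+
  have dir: "directed_set I le" and central: "\<And>a i. i \<in> I \<Longrightarrow> a * e i = e i * a"
    and approx: "\<And>a. ((\<lambda>i. e i * a) \<longlongrightarrow> a) (net_filter I le)"
    using assms(2) unfolding central_approximate_identity_def by blast+
  have in_net: "eventually (\<lambda>i. i \<in> I) (net_filter I le)"
    using dir by (auto simp: eventually_net_filter directed_set_def)
  have commutator: "lact ?E a (\<rho> (e i)) - ract ?E (\<rho> (e i)) a = 0" if "i \<in> I" for a i
    by (simp flip: left right add: central[OF that])
  obtain J :: "((('a tensor \<Rightarrow> complex) \<Rightarrow> complex) set \<times> (('a tensor \<Rightarrow> complex) \<Rightarrow> complex)) set"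
    and le' n where dirJ: "directed_set J le'" and ran: "n ` J = (\<lambda>i. \<rho> (e i)) ` I"
    and filt: "filtermap n (net_filter J le') = filtermap (\<lambda>i. \<rho> (e i)) (net_filter I le)"
    using net_reindex[OF dir, of "\<lambda>i. \<rho> (e i)"] by metis
  have from_e: "\<exists>i\<in>I. n j = \<rho> (e i)" if "j \<in> J" for j
    using ran that by blast
  have "limitin (weak_star_dual (swc_tensor P)) (\<lambda>j. lact ?E a (n j) - ract ?E (n j) a) 0
      (net_filter J le')" for a
  proof -
    have "limitin (weak_star_dual (swc_tensor P))
        (\<lambda>i. lact ?E a (\<rho> (e i)) - ract ?E (\<rho> (e i)) a) 0 (net_filter I le)"
    proof (rule limitin_eventually)
      show "0 \<in> topspace (weak_star_dual (swc_tensor P))"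
        by (simp add: weak_star_dual_def zero_in_carr_dual)
      show "\<forall>\<^sub>F i in net_filter I le. lact ?E a (\<rho> (e i)) - ract ?E (\<rho> (e i)) a = 0"
        using in_net by eventually_elim (rule commutator)
    qed
    then show ?thesis
      using limitin_filtermap_cong[OF filt, where h = "\<lambda>x. lact ?E a x - ract ?E x a"] by blast
  qed
  moreover have "limitin (weak_star P) (\<lambda>j. a * pi_swc P (n j)) a (net_filter J le')" for a
  proof -
    have "((\<lambda>i. a * e i) \<longlongrightarrow> a) (net_filter I le)"
    proof (rule Lim_transform_eventually[OF approx])
      show "\<forall>\<^sub>F i in net_filter I le. e i * a = a * e i"
        using in_net by eventually_elim (simp add: central)
    qed
    then have "limitin (weak_star P) (\<lambda>i. a * pi_swc P (\<rho> (e i))) a (net_filter I le)"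
      using limitin_weak_star[OF assms(1)] by (simp add: split)
    then show ?thesis
      using limitin_filtermap_cong[OF filt, where h = "\<lambda>x. a * pi_swc P x"] by blast
  qed
  moreover have "n j \<in> carr ?E" "a * pi_swc P (n j) = pi_swc P (n j) * a" if "j \<in> J" for j a
    using from_e[OF that] carr split central by force+
  ultimately show ?thesis
    unfolding strong_pseudo_Connes_amenable_def
    using dirJ by (intro exI[of _ J] exI[of _ le'] exI[of _ n]) blast
qed

end
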